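(* Let $G$ be a finite simple graph that is $\delta$-dense, and suppose that $G$ and $G^2$ have nested solutions. Label $V_G=\{0,1,\dots,|V_G|-1\}$ according to an optimal order of $G$. Let $\mathcal{O}$ be a compressed optimal order on $G^2$ (with respect to this labeling). Then $\mathcal{O}$ is the lexicographic order $\mathcal{L}$ or the colexicographic order $\mathcal{C}$ on $V_G\times V_G$.
   Context: All graphs are finite and simple. For a graph $G=(V,E)$ and $A\subseteq V$, let $I_G(A)$ be the set of edges of $G$ with both endpoints in $A$, and for $0\le m\le |V|$ let $I_G(m)=\max_{A\subseteq V,\,|A|=m}|I_G(A)|$. A set $A$ with $|A|=m$ and $|I_G(A)|=I_G(m)$ is called optimal. $G$ has nested solutions (NS) if there are sets $A_1\subseteq\cdots\subseteq A_{|V|}$ with $|A_i|=i$ and each $A_i$ optimal; the resulting total order on $V$ (in which the vertex of $A_i\setminus A_{i-1}$ is the $i$-th vertex) is called an optimal order, and labeling the vertices $0,1,\dots,|V|-1$ in this order makes every initial segment $\{0,\dots,k-1\}$ optimal. The $\delta$-sequence of $G$ is $\delta_G(m)=I_G(m)-I_G(m-1)$, $1\le m\le |V|$. Partition $\delta_G$ into consecutive maximal strictly increasing runs ("monotonic segments"); let $r$ be their number and $s_{G,i}$ the first value of the $i$-th run. $G$ is $\delta$-dense iff $s_{G,2},\dots,s_{G,r}>1$. $G^2=G\square G$ has vertex set $V_G\times V_G$, with $(x,y)\sim(u,v)$ iff ($x=u$ and $\{y,v\}\in E_G$) or ($\{x,u\}\in E_G$ and $y=v$). A set $A\subseteq V_G\times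 V_G$ is compressed if for every $a$, the sets $\{y:(a,y)\in A\}$ and $\{x:(x,a)\in A\}$ are each of the form $\{0,1,\dots,k-1\}$ for some $k\ge 0$. A compressed optimal order on $G^2$ is a total order on $V_G\times V_G$ such that every initial segment is both compressed and optimal in $G^2$. The lexicographic order: $(x_1,x_2)<_{\mathcal{L}}(y_1,y_2)$ iff $x_1<y_1$, or $x_1=y_1$ and $x_2<y_2$. The colexicographic order: $(x_1,x_2)<_{\mathcal{C}}(y_1,y_2)$ iff $x_2<y_2$, or $x_2=y_2$ and $x_1<y_1$. *)

theory Defs
  imports Main
begin

definition simple_graph :: "'a set \<Rightarrow> 'a set set \<Rightarrow> bool" where
  "simple_graph V E \<longleftrightarrow> finite V \<and> E \<subseteq> {{u, v} |u v. u \<in> V \<and> v \<in> V \<and> u \<noteq> v}"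

definition induced_edges :: "'a set set \<Rightarrow> 'a set \<Rightarrow> 'a set set" where
  "induced_edges E A = {e \<in> E. e \<subseteq> A}"

text \<open>Only meaningful for \<open>m \<le> card V\<close>, where the maximum is over a nonempty set.\<close>

definition max_induced :: "'a set \<Rightarrow> 'a set set \<Rightarrow> nat \<Rightarrow> nat" where
  "max_induced V E m = Max {card (induced_edges E A) |A. A \<subseteq> V \<and> card A = m}"

definition optimal_set :: "'a set \<Rightarrow> 'a set set \<Rightarrow> 'a set \<Rightarrow> bool" where
  "optimal_set V E A \<longleftrightarrow> A \<subseteq> V \<and> card (induced_edges E A) = max_induced V E (card A)"

definition nested_solutions :: "'a set \<Rightarrow> 'a set set \<Rightarrow> bool" where
  "nested_solutions V E \<longleftrightarrow>
    (\<exists>A :: nat \<Rightarrow> 'a set.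
      (\<forall>i\<in>{1..card V}. card (A i) = i \<and> optimal_set V E (A i)) \<and>
      (\<forall>i\<in>{1..<card V}. A i \<subseteq> A (Suc i)))"

definition optimal_labeling :: "'a set \<Rightarrow> 'a set set \<Rightarrow> ('a \<Rightarrow> nat) \<Rightarrow> bool" where
  "optimal_labeling V E lab \<longleftrightarrow>
    bij_betw lab V {0..<card V} \<and>
    (\<forall>k\<le>card V. optimal_set V E {v \<in> V. lab v < k})"

definition delta :: "'a set \<Rightarrow> 'a set set \<Rightarrow> nat \<Rightarrow> int" where
  "delta V E m = int (max_induced V E m) - int (max_induced V E (m - 1))"

definition delta_seq :: "'a set \<Rightarrow> 'a set set \<Rightarrow> int list" where
  "delta_seq V E = map (delta V E) [1..<card V + 1]"

text \<open>
  Decomposition of a list into its maximal strictly increasing contiguous runs; the lemmas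
  following the definition determine the result uniquely.
\<close>

fun monotonic_segments :: "'a::linorder list \<Rightarrow> 'a list list" where
  "monotonic_segments [] = []"
| "monotonic_segments [x] = [[x]]"
| "monotonic_segments (x # y # zs) =
    (let segs = monotonic_segments (y # zs)
     in if x < y then (x # hd segs) # tl segs else [x] # segs)"

lemma monotonic_segments_Cons:
  "\<exists>ys segs. monotonic_segments (x # xs) = (x # ys) # segs"
  by (induction xs arbitrary: x) (auto simp: Let_def)

lemma concat_monotonic_segments: "concat (monotonic_segments xs) = xs"
proof (induction xs rule: monotonic_segments.induct)
  case (3 x y zs)
  obtain ys segs where "monotonic_segments (y # zs) = (y # ys) # segs"
    using monotonic_segments_Cons by blast
  with 3 show ?case by (auto simp: Let_def)
qed auto

lemma monotonic_segments_increasing: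
  "s \<in> set (monotonic_segments xs) \<Longrightarrow> s \<noteq> [] \<and> sorted_wrt (<) s"
proof (induction xs arbitrary: s rule: monotonic_segments.induct)
  case (3 x y zs)
  obtain ys segs where *: "monotonic_segments (y # zs) = (y # ys) # segs"
    using monotonic_segments_Cons by blast
  have "sorted_wrt (<) (y # ys)"
    using "3.IH" * by fastforce
  moreover from this have "x < y \<Longrightarrow> \<forall>z\<in>set ys. x < z"
    by (meson less_trans sorted_wrt.simps(2))
  ultimately show ?case using 3 *
    by (auto simp: Let_def split: if_splits)
qed auto

lemma monotonic_segments_maximal:
  "Suc i < length (monotonic_segments xs) \<Longrightarrow>
    hd (monotonic_segments xs ! Suc i) \<le> last (monotonic_segments xs ! i)"
proof (induction xs arbitrary: i rule: monotonic_segments.induct)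
  case (3 x y zs)
  obtain ys segs where *: "monotonic_segments (y # zs) = (y # ys) # segs"
    using monotonic_segments_Cons by blast
  have IH: "Suc j < length ((y # ys) # segs) \<Longrightarrow>
      hd (((y # ys) # segs) ! Suc j) \<le> last (((y # ys) # segs) ! j)" for j
    using "3.IH"[of j] * by simp
  from "3.prems" * IH[of i] IH[of "i - 1"] show ?case
    by (cases i) (auto simp: Let_def split: if_splits)
qed auto

definition delta_dense :: "'a set \<Rightarrow> 'a set set \<Rightarrow> bool" where
  "delta_dense V E \<longleftrightarrow> (\<forall>s \<in> set (tl (monotonic_segments (delta_seq V E))). hd s > 1)"

definition square_edges :: "'a set \<Rightarrow> 'a set set \<Rightarrow> ('a \<times> 'a) set set" where
  "square_edges V E =
    {{(x, y), (u, v)} |x y u v.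
      x \<in> V \<and> y \<in> V \<and> u \<in> V \<and> v \<in> V \<and>
      (x = u \<and> {y, v} \<in> E \<or> {x, u} \<in> E \<and> y = v)}"

definition compressed :: "'a set \<Rightarrow> ('a \<Rightarrow> nat) \<Rightarrow> ('a \<times> 'a) set \<Rightarrow> bool" where
  "compressed V lab A \<longleftrightarrow>
    A \<subseteq> V \<times> V \<and>
    (\<forall>a\<in>V. (\<exists>k. lab ` {y. (a, y) \<in> A} = {0..<k}) \<and> (\<exists>k. lab ` {x. (x, a) \<in> A} = {0..<k}))"

text \<open>
  Total orders are reflexive relations on their carrier; their initial segments are the
  order filters \<open>ofilter\<close> (the downward closed subsets of the carrier).
\<close>

definition compressed_optimal_order ::
    "'a set \<Rightarrow> 'a set set \<Rightarrow> ('a \<Rightarrow> nat) \<Rightarrow> ('a \<times> 'a) rel \<Rightarrow> bool" where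
  "compressed_optimal_order V E lab r \<longleftrightarrow>
    linear_order_on (V \<times> V) r \<and>
    (\<forall>S. ofilter r S \<longrightarrow> compressed V lab S \<and> optimal_set (V \<times> V) (square_edges V E) S)"

fun lex_less :: "('a \<Rightarrow> nat) \<Rightarrow> 'a \<times> 'a \<Rightarrow> 'a \<times> 'a \<Rightarrow> bool" where
  "lex_less lab (x\<^sub>1, x\<^sub>2) (y\<^sub>1, y\<^sub>2) \<longleftrightarrow>
    lab x\<^sub>1 < lab y\<^sub>1 \<or> lab x\<^sub>1 = lab y\<^sub>1 \<and> lab x\<^sub>2 < lab y\<^sub>2"

fun colex_less :: "('a \<Rightarrow> nat) \<Rightarrow> 'a \<times> 'a \<Rightarrow> 'a \<times> 'a \<Rightarrow> bool" where
  "colex_less lab (x\<^sub>1, x\<^sub>2) (y\<^sub>1, y\<^sub>2) \<longleftrightarrow>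
    lab x\<^sub>2 < lab y\<^sub>2 \<or> lab x\<^sub>2 = lab y\<^sub>2 \<and> lab x\<^sub>1 < lab y\<^sub>1"

definition lex_order :: "'a set \<Rightarrow> ('a \<Rightarrow> nat) \<Rightarrow> ('a \<times> 'a) rel" where
  "lex_order V lab = {(p, q). p \<in> V \<times> V \<and> q \<in> V \<times> V \<and> (p = q \<or> lex_less lab p q)}"

definition colex_order :: "'a set \<Rightarrow> ('a \<Rightarrow> nat) \<Rightarrow> ('a \<times> 'a) rel" where
  "colex_order V lab = {(p, q). p \<in> V \<times> V \<and> q \<in> V \<times> V \<and> (p = q \<or> colex_less lab p q)}"

end

theory Submission
  imports Defs
begin

text \<open>
  Write \<open>d j\<close> for the number of neighbours of vertex \<open>j\<close> among \<open>0, \<dots>, j - 1\<close>. A compressed set \<open>S\<close>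
  induces exactly the sum of \<open>d x + d y\<close> over \<open>(x, y) \<in> S\<close> edges of the square, so a compressed optimal
  order always appends a corner of maximal weight. Density forces \<open>d j \<ge> 2\<close> for \<open>j \<ge> 2\<close>, and optimality
  of the labeling gives \<open>d (c + 1) \<le> d c + 1\<close> together with
  \<open>(\<Sum>j<m. d (c + j)) \<le> m * d c + (\<Sum>j<m. d j)\<close>.

  Up to symmetry the order starts with \<open>(0, 0), (0, 1)\<close>. Once \<open>(c, 0)\<close> and \<open>(c, 1)\<close> have been added to
  \<open>c\<close> full columns, the rest of column \<open>c\<close> is forced, because \<open>d c + d j \<ge> d c + 2 > d (c + 1)\<close>. After
  \<open>(c, 0)\<close> the only alternative to \<open>(c, 1)\<close> is to run along the bottom row for \<open>j \<ge> 2\<close> steps and then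
  return to \<open>(c, 1)\<close>. By the displayed inequality the row gains no more than \<open>j\<close> steps in the column
  would, and the return gains at most \<open>d c + 1\<close> where the column would gain \<open>d c + d j\<close>, contradicting
  optimality.
\<close>

section \<open>Chains of lower sets in the grid\<close>

definition lower_set :: "(nat \<times> nat) set \<Rightarrow> bool" where
  "lower_set S \<longleftrightarrow> (\<forall>x y x' y'. (x, y) \<in> S \<longrightarrow> x' \<le> x \<longrightarrow> y' \<le> y \<longrightarrow> (x', y') \<in> S)"

text \<open>These are the initial segments of the lexicographic order on the grid, with the first
  coordinate read as the column number. A full column \<open>c\<close> and an empty column
  \<open>c + 1\<close> describe the same set, which is how the chain passes to the next
  column.\<close>

definition lex_segment :: "nat \<Rightarrow> nat \<Rightarrow> nat \<Rightarrow> (nat \<times> nat) set" where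
  "lex_segment n c j = {..<c} \<times> {..<n} \<union> {c} \<times> {..<j}"

definition weight :: "(nat \<Rightarrow> nat) \<Rightarrow> (nat \<times> nat) set \<Rightarrow> nat" where
  "weight d S = (\<Sum>p\<in>S. d (fst p) + d (snd p))"

lemma lower_setD: "lower_set S \<Longrightarrow> (x, y) \<in> S \<Longrightarrow> x' \<le> x \<Longrightarrow> y' \<le> y \<Longrightarrow> (x', y') \<in> S"
  unfolding lower_set_def by blast

text \<open>A cell of maximal coordinate sum lies below no other cell of the set, so deleting it
  leaves a lower set. Every finite lower set can thus be built up corner by corner.\<close>

lemma lower_set_induct [consumes 2, case_names empty insert]:
  assumes "finite A" "lower_set A"
    and "P {}"
    and step: "\<And>x y A. finite A \<Longrightarrow> lower_set A \<Longrightarrow> lower_set (insert (x, y) A) \<Longrightarrow> (x, y) \<notin> A \<Longrightarrow>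
      P A \<Longrightarrow> P (insert (x, y) A)"
  shows "P A"
  using assms(1,2)
proof (induction A rule: finite_psubset_induct)
  case (psubset A)
  show ?case
  proof (cases "A = {}")
    case False
    let ?h = "\<lambda>p. fst p + snd p"
    have "Max (?h ` A) \<in> ?h ` A" using False psubset by simp
    then obtain x y where xy: "(x, y) \<in> A" "x + y = Max (?h ` A)" by auto
    have max: "a + b \<le> x + y" if "(a, b) \<in> A" for a b
      using imageI[OF that, of ?h] psubset.hyps xy(2) by simp
    have lower: "lower_set (A - {(x, y)})"
      unfolding lower_set_def
    proof (intro allI impI)
      fix a b a' b' assume *: "(a, b) \<in> A - {(x, y)}" "a' \<le> a" "b' \<le> b"
      then have "a + b \<le> x + y" using max by simp
      then have "(a', b') \<noteq> (x, y)" using * by auto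
      then show "(a', b') \<in> A - {(x, y)}"
        using * lower_setD[OF psubset.prems] by blast
    qed
    have ins: "insert (x, y) (A - {(x, y)}) = A" using xy by blast
    have "P (insert (x, y) (A - {(x, y)}))"
      by (rule step) (use psubset xy lower ins in auto)
    then show ?thesis using ins by simp
  qed (use assms(3) in simp)
qed

lemma lower_set_lex_segment: "j \<le> n \<Longrightarrow> lower_set (lex_segment n c j)"
  unfolding lower_set_def lex_segment_def by auto

lemma lex_segment_subset: "c < n \<Longrightarrow> j \<le> n \<Longrightarrow> lex_segment n c j \<subseteq> {..<n} \<times> {..<n}"
  unfolding lex_segment_def by auto

lemma lex_segment_Suc: "lex_segment n c (Suc j) = insert (c, j) (lex_segment n c j)"
  unfolding lex_segment_def by auto

lemma lex_segment_full: "lex_segment n c n = lex_segment n (Suc c) 0"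
  unfolding lex_segment_def by auto

lemma finite_lex_segment [simp]: "finite (lex_segment n c j)"
  unfolding lex_segment_def by auto

lemma weight_insert:
  "finite S \<Longrightarrow> (x, y) \<notin> S \<Longrightarrow> weight d (insert (x, y) S) = d x + d y + weight d S"
  unfolding weight_def by simp

lemma mem_swap_image: "(x, y) \<in> prod.swap ` S \<longleftrightarrow> (y, x) \<in> S"
  by force

lemma lower_set_swap: "lower_set (prod.swap ` S) \<longleftrightarrow> lower_set S"
  unfolding lower_set_def mem_swap_image by blast

lemma weight_swap: "weight d (prod.swap ` S) = weight d S"
  unfolding weight_def by (subst sum.reindex) (auto simp: add.commute)

lemma mem_image_swap_iff: "A \<in> (`) prod.swap ` F \<longleftrightarrow> prod.swap ` A \<in> F"
proof
  assume "prod.swap ` A \<in> F"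
  then have "prod.swap ` prod.swap ` A \<in> (`) prod.swap ` F" by (rule imageI)
  then show "A \<in> (`) prod.swap ` F" by (simp add: image_image)
qed (auto simp: image_image)

text \<open>
  \<open>F\<close> is the family of initial segments of a compressed optimal order, read through the labels.
\<close>

locale staircase_chain =
  fixes n :: nat and d :: "nat \<Rightarrow> nat" and F :: "(nat \<times> nat) set set"
  assumes d_0: "d 0 = 0"
    and d_Suc: "Suc c < n \<Longrightarrow> d (Suc c) \<le> d c + 1"
    and d_ge_2: "2 \<le> j \<Longrightarrow> j < n \<Longrightarrow> 2 \<le> d j"
    and sum_shift: "c + m \<le> n \<Longrightarrow> (\<Sum>j<m. d (c + j)) \<le> m * d c + (\<Sum>j<m. d j)"
    and empty_mem: "{} \<in> F"
    and mem_subset: "S \<in> F \<Longrightarrow> S \<subseteq> {..<n} \<times> {..<n}"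
    and mem_lower: "S \<in> F \<Longrightarrow> lower_set S"
    and mem_step: "S \<in> F \<Longrightarrow> S \<noteq> {..<n} \<times> {..<n} \<Longrightarrow> \<exists>p. p \<notin> S \<and> insert p S \<in> F"
    and mem_opt: "S \<in> F \<Longrightarrow> T \<subseteq> {..<n} \<times> {..<n} \<Longrightarrow> lower_set T \<Longrightarrow> card T = card S \<Longrightarrow>
      weight d T \<le> weight d S"
begin

lemma mem_finite: "S \<in> F \<Longrightarrow> finite S"
  using mem_subset finite_subset by blast

text \<open>The enlarged set is again lower, so the added cell is a corner: its left and lower
  neighbours, where they exist, are already present. The cell \<open>q\<close> witnesses that
  \<open>S\<close> is not yet the whole grid.\<close>

lemma mem_stepE:
  assumes "S \<in> F" "q \<in> {..<n} \<times> {..<n}" "q \<notin> S"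
  obtains x y where "(x, y) \<notin> S" "insert (x, y) S \<in> F" "x < n" "y < n"
    "x = 0 \<or> (x - 1, y) \<in> S" "y = 0 \<or> (x, y - 1) \<in> S"
proof -
  obtain x y where p: "(x, y) \<notin> S" "insert (x, y) S \<in> F"
    using mem_step[OF assms(1)] assms(2,3) by (metis surj_pair)
  \<comment> \<open>At coordinate 0 the truncated subtraction returns the cell itself, which is why
    \<open>insert\<close> is needed here.\<close>
  have "(x - 1, y) \<in> insert (x, y) S" "(x, y - 1) \<in> insert (x, y) S"
    using lower_setD[OF mem_lower[OF p(2)], of x y "x - 1" y]
      lower_setD[OF mem_lower[OF p(2)], of x y x "y - 1"] by simp_all
  then have "x = 0 \<or> (x - 1, y) \<in> S" "y = 0 \<or> (x, y - 1) \<in> S"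
    by auto
  moreover have "x < n" "y < n"
    using mem_subset[OF p(2)] by auto
  ultimately show thesis using that p by blast
qed

lemma greedy:
  assumes "S \<in> F" "(x, y) \<notin> S" "insert (x, y) S \<in> F" "(u, v) \<notin> S"
    and "lower_set (insert (u, v) S)" "u < n" "v < n"
  shows "d u + d v \<le> d x + d y"
proof -
  have fin: "finite S" using assms(1) by (rule mem_finite)
  have "weight d (insert (u, v) S) \<le> weight d (insert (x, y) S)"
    by (rule mem_opt) (use assms fin mem_subset[OF assms(1)] in auto)
  then show ?thesis using assms fin by (simp add: weight_insert)
qed

text \<open>The possible next cells are \<open>(c, j)\<close> and, if \<open>j > 0\<close>, also
  \<open>(c + 1, 0)\<close>. For \<open>j \<ge> 2\<close> the second one is too light. The case
  \<open>j = 1\<close> is excluded because \<open>d 1\<close> may be too small for this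
  comparison.\<close>

lemma lex_segment_step:
  assumes "lex_segment n c j \<in> F" "c < n" "j < n" "j \<noteq> 1"
  shows "lex_segment n c (Suc j) \<in> F"
proof -
  let ?S = "lex_segment n c j"
  have "(c, j) \<notin> ?S" by (auto simp: lex_segment_def)
  then obtain x y where p: "(x, y) \<notin> ?S" "insert (x, y) ?S \<in> F" "x < n" "y < n"
    "x = 0 \<or> (x - 1, y) \<in> ?S" "y = 0 \<or> (x, y - 1) \<in> ?S"
    using mem_stepE[OF assms(1), of "(c, j)"] assms by auto
  then consider "x = c" "y = j" | "x = Suc c" "y = 0" "j > 0"
    by (auto simp: lex_segment_def)
  then show ?thesis
  proof cases
    case 1
    then show ?thesis using p by (simp add: lex_segment_Suc)
  next
    case 2
    have "lower_set (insert (c, j) ?S)"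
      using lower_set_lex_segment[of "Suc j" n c] assms by (simp add: lex_segment_Suc)
    then have "d c + d j \<le> d (Suc c)"
      using greedy[OF assms(1) p(1,2), of c j] \<open>(c, j) \<notin> ?S\<close> assms 2 d_0 by simp
    moreover have "2 \<le> d j" using assms 2 by (intro d_ge_2) auto
    ultimately show ?thesis using d_Suc[of c] p(3) 2 by simp
  qed
qed

lemma lex_segment_step_1:
  assumes "lex_segment n c 1 \<in> F" "0 < c" "c < n"
  shows "lex_segment n c 2 \<in> F"
proof (rule ccontr)
  assume contr: "lex_segment n c 2 \<notin> F"
  let ?S = "lex_segment n c 0"
  \<comment> \<open>\<open>R j\<close> is the deviating path: \<open>c\<close> full columns followed
    by \<open>j\<close> cells along the bottom row.\<close>
  define R where "R j = ?S \<union> {c..<c + j} \<times> {0}" for j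
  have R_Suc: "R (Suc j) = insert (c + j, 0) (R j)" for j
    unfolding R_def by auto
  have R_notin: "(c + j, 0) \<notin> R j" for j
    unfolding R_def by (auto simp: lex_segment_def)
  have col_notin: "(c, 1) \<notin> R j" for j
    unfolding R_def by (auto simp: lex_segment_def)
  have R_fin: "finite (R j)" for j
    unfolding R_def by simp
  have R_0: "R 0 = ?S" unfolding R_def by simp
  have R_1: "R 1 = lex_segment n c 1" using R_Suc[of 0] R_0 by (simp add: lex_segment_Suc)
  have col_Suc: "(c, j) \<notin> lex_segment n c j" for j
    by (auto simp: lex_segment_def)
  have card_R: "card (R j) = card (lex_segment n c j)" for j
    by (induction j) (auto simp: R_0 R_Suc R_notin R_fin lex_segment_Suc col_Suc)
  have weight_R: "weight d (R j) = weight d ?S + (\<Sum>i<j. d (c + i))" for j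
    by (induction j) (auto simp: R_0 R_Suc weight_insert R_notin R_fin d_0)
  have weight_col: "weight d (lex_segment n c j) = weight d ?S + (j * d c + (\<Sum>i<j. d i))" for j
    by (induction j) (auto simp: lex_segment_Suc weight_insert col_Suc)
  \<comment> \<open>For \<open>j = 1\<close> the return to \<open>(c, 1)\<close> is the segment
    excluded by \<open>contr\<close>; for larger \<open>j\<close> it is compared with a set of equal
    size that fills column \<open>c\<close> instead.\<close>
  have no_return: "insert (c, 1) (R j) \<notin> F" if j: "1 \<le> j" "c + j \<le> n" for j
  proof
    assume mem: "insert (c, 1) (R j) \<in> F"
    show False
    proof (cases "j = 1")
      case True
      then have "insert (c, 1) (R j) = lex_segment n c 2"
        using R_1 by (simp add: numeral_2_eq_2 lex_segment_Suc)
      then show False using mem contr by simp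
    next
      case False
      \<comment> \<open>Since \<open>0 < c\<close>, the bound \<open>c + j \<le> n\<close> gives
        \<open>j < n\<close>, so column \<open>c\<close> has room for \<open>j + 1\<close>
        cells.\<close>
      have "weight d (lex_segment n c (Suc j)) \<le> weight d (insert (c, 1) (R j))"
      proof (rule mem_opt[OF mem])
        show "lex_segment n c (Suc j) \<subseteq> {..<n} \<times> {..<n}" "lower_set (lex_segment n c (Suc j))"
          using j assms by (simp_all add: lex_segment_subset lower_set_lex_segment)
        show "card (lex_segment n c (Suc j)) = card (insert (c, 1) (R j))"
          using card_R[of j] col_notin[of j] col_Suc[of j] R_fin[of j] by (simp add: lex_segment_Suc)
      qed
      then have "Suc j * d c + (\<Sum>i<Suc j. d i) \<le> d c + d 1 + (\<Sum>i<j. d (c + i))"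
        using weight_col[of "Suc j"] weight_insert[OF R_fin[of j] col_notin[of j], of d] weight_R[of j] by simp
      moreover have "d 1 \<le> 1" using d_Suc[of 0] d_0 assms by simp
      moreover have "2 \<le> d j" using False j assms by (intro d_ge_2) auto
      \<comment> \<open>Cancelling by means of \<open>sum_shift\<close> leaves
        \<open>d j \<le> d 1 \<le> 1\<close>.\<close>
      ultimately show False using sum_shift[OF j(2)] by simp
    qed
  qed
  \<comment> \<open>With the return excluded, each further cell must extend the bottom row. The row
    would then leave the grid: taking \<open>j = n - c\<close> yields \<open>n < n\<close>.\<close>
  have R_mem: "c + j \<le> n \<Longrightarrow> 1 \<le> j \<Longrightarrow> R (Suc j) \<in> F \<and> c + j < n" for j
  proof (induction j)
    case (Suc j)
    have mem: "R (Suc j) \<in> F"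
    proof (cases "j = 0")
      case True
      then show ?thesis using R_1 assms by simp
    next
      case False
      then show ?thesis using Suc by simp
    qed
    obtain x y where p: "(x, y) \<notin> R (Suc j)" "insert (x, y) (R (Suc j)) \<in> F" "x < n" "y < n"
      "x = 0 \<or> (x - 1, y) \<in> R (Suc j)" "y = 0 \<or> (x, y - 1) \<in> R (Suc j)"
      using mem_stepE[OF mem, of "(c, 1)"] col_notin assms by auto
    have ne: "\<not> (x = c \<and> y = 1)"
      using p(2) no_return[of "Suc j"] Suc.prems by auto
    have R_iff: "(a, b) \<in> R (Suc j) \<longleftrightarrow> a < c \<and> b < n \<or> c \<le> a \<and> a \<le> c + j \<and> b = 0" for a b
      by (auto simp: R_def lex_segment_def)
    have "x = c + Suc j \<and> y = 0"
    proof (cases "y = 0")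
      case True
      then show ?thesis using p(1,5) assms(2,3) by (auto simp: R_iff)
    next
      case False
      then have "c \<le> x" "y = 1" using p(1,4,6) by (auto simp: R_iff)
      then have "x = c" using p(5) assms(2) by (auto simp: R_iff)
      then show ?thesis using ne \<open>y = 1\<close> by simp
    qed
    then show ?case using p(2,3) R_Suc[of "Suc j"] by simp
  qed simp
  moreover have "c + (n - c) = n" "1 \<le> n - c" using assms by auto
  ultimately show False by (metis order.refl less_irrefl)
qed

text \<open>From a single cell, the two possible continuations are mirror images. The hypothesis
  \<open>start\<close> settles this choice; afterwards every step is forced.\<close>

lemma lex_segment_mem:
  assumes start: "1 < n \<Longrightarrow> lex_segment n 0 2 \<in> F"
  shows "c < n \<Longrightarrow> j \<le> n \<Longrightarrow> lex_segment n c j \<in> F"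
proof (induction c arbitrary: j)
  case outer: 0
  show ?case using outer.prems(2)
  proof (induction j)
    case 0
    then show ?case using empty_mem by (simp add: lex_segment_def)
  next
    case (Suc j)
    then show ?case using start lex_segment_step[of 0 j] outer.prems
      by (cases "j = 1") (auto simp: numeral_2_eq_2)
  qed
next
  case outer: (Suc c)
  show ?case using outer.prems(2)
  proof (induction j)
    case 0
    then show ?case using outer.IH[of n] outer.prems lex_segment_full[of n c] by simp
  next
    case (Suc j)
    then show ?case using lex_segment_step_1[of "Suc c"] lex_segment_step[of "Suc c" j] outer.prems
      by (cases "j = 1") (auto simp: numeral_2_eq_2)
  qed
qed

end

text \<open>Transposing the grid preserves lower sets, sizes and weights, so the colexicographic
  case follows from the lexicographic one.\<close>

lemma (in staircase_chain) swap_chain: "staircase_chain n d ((`) prod.swap ` F)"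
proof
  fix S assume S: "S \<in> (`) prod.swap ` F" "S \<noteq> {..<n} \<times> {..<n}"
  have "prod.swap ` S \<noteq> {..<n} \<times> {..<n}"
  proof
    assume "prod.swap ` S = {..<n} \<times> {..<n}"
    then have "prod.swap ` prod.swap ` S = {..<n} \<times> {..<n}" by (simp only: product_swap)
    then show False using S(2) by (simp add: image_image)
  qed
  then obtain p where "p \<notin> prod.swap ` S" "insert p (prod.swap ` S) \<in> F"
    using mem_step S(1) unfolding mem_image_swap_iff by blast
  then have "prod.swap p \<notin> S \<and> insert (prod.swap p) S \<in> (`) prod.swap ` F"
    unfolding mem_image_swap_iff by (force simp: image_iff)
  then show "\<exists>p. p \<notin> S \<and> insert p S \<in> (`) prod.swap ` F" by blast
next
  fix S T assume S: "S \<in> (`) prod.swap ` F" and T: "T \<subseteq> {..<n} \<times> {..<n}" "lower_set T" "card T = card S"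
  then obtain S' where S': "S' \<in> F" "S = prod.swap ` S'" by blast
  have "weight d (prod.swap ` T) \<le> weight d S'"
    by (rule mem_opt) (use S' T in \<open>auto simp: lower_set_swap card_image\<close>)
  then show "weight d T \<le> weight d S"
    using S' by (simp add: weight_swap)
next
  fix S assume "S \<in> (`) prod.swap ` F"
  then obtain T where T: "T \<in> F" "S = prod.swap ` T" by blast
  show "S \<subseteq> {..<n} \<times> {..<n}" using T(2) mem_subset[OF T(1)] by auto
  show "lower_set S" using T(2) mem_lower[OF T(1)] by (simp add: lower_set_swap)
qed (use d_0 d_Suc d_ge_2 sum_shift empty_mem in auto)

text \<open>The second cell of the chain, \<open>(0, 1)\<close> or \<open>(1, 0)\<close>, decides
  between the two orders. If \<open>n \<le> 1\<close> there is no such cell and the premise of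
  \<open>start\<close> is false.\<close>

lemma (in staircase_chain) lex_or_colex:
  "(\<forall>c<n. \<forall>j\<le>n. lex_segment n c j \<in> F) \<or> (\<forall>c<n. \<forall>j\<le>n. prod.swap ` lex_segment n c j \<in> F)"
proof -
  consider "n \<le> 1" | "lex_segment n 0 2 \<in> F" | "prod.swap ` lex_segment n 0 2 \<in> F"
  proof (cases "1 < n")
    case True
    have "lex_segment n 0 1 \<in> F"
      using lex_segment_step[of 0 0] empty_mem True by (simp add: lex_segment_def)
    then obtain x y where p: "(x, y) \<notin> lex_segment n 0 1" "insert (x, y) (lex_segment n 0 1) \<in> F"
      "x = 0 \<or> (x - 1, y) \<in> lex_segment n 0 1" "y = 0 \<or> (x, y - 1) \<in> lex_segment n 0 1"
    proof (rule mem_stepE)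
      show "(0, 1) \<in> {..<n} \<times> {..<n}" "(0, 1) \<notin> lex_segment n 0 1"
        using True by (auto simp: lex_segment_def)
    qed
    then consider "x = 0" "y = 1" | "x = 1" "y = 0"
      by (auto simp: lex_segment_def)
    then show ?thesis
    proof cases
      case 1
      then show ?thesis using p that by (simp add: numeral_2_eq_2 lex_segment_Suc)
    next
      case 2
      have "prod.swap ` lex_segment n 0 2 = insert (1, 0) (lex_segment n 0 1)"
        by (auto simp: lex_segment_def image_iff)
      then show ?thesis using 2 p that by simp
    qed
  qed (use that in simp)
  then show ?thesis
  proof cases
    case 1
    then show ?thesis using lex_segment_mem by auto
  next
    case 2
    then show ?thesis using lex_segment_mem by auto
  next
    case 3
    interpret swapped: staircase_chain n d "(`) prod.swap ` F" by (rule swap_chain)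
    have "lex_segment n 0 2 \<in> (`) prod.swap ` F"
      using 3 by (simp add: mem_image_swap_iff)
    then have "\<forall>c<n. \<forall>j\<le>n. lex_segment n c j \<in> (`) prod.swap ` F"
      using swapped.lex_segment_mem by blast
    then have "\<forall>c<n. \<forall>j\<le>n. prod.swap ` lex_segment n c j \<in> F"
      by (simp add: mem_image_swap_iff)
    then show ?thesis by blast
  qed
qed

section \<open>Growth along strictly increasing runs\<close>

lemma sorted_wrt_less_int_nth:
  fixes xs :: "int list"
  assumes "sorted_wrt (<) xs" "i < length xs"
  shows "xs ! 0 + int i \<le> xs ! i"
  using assms(2)
proof (induction i)
  case (Suc i)
  then have "xs ! i < xs ! Suc i" using sorted_wrt_nth_less[OF assms(1)] by blast
  then show ?case using Suc by simp
qed simp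

text \<open>The first disjunct covers positions in the first run, where integers grow by at least
  one per step. Each later run starts above 1 and increases from there.\<close>

lemma monotonic_segments_nth:
  fixes xs :: "int list"
  assumes "\<forall>s\<in>set (tl (monotonic_segments xs)). 1 < hd s" "i < length xs"
  shows "xs ! 0 + int i \<le> xs ! i \<or> 1 < xs ! i"
proof -
  obtain x xs' where "xs = x # xs'" using assms(2) by (cases xs) auto
  then obtain s segs where segs: "monotonic_segments xs = s # segs" "s \<noteq> []"
    using monotonic_segments_Cons by blast
  have xs: "xs = s @ concat segs"
    using concat_monotonic_segments[of xs] segs by simp
  show ?thesis
  proof (cases "i < length s")
    case True
    have "sorted_wrt (<) s" using monotonic_segments_increasing[of s xs] segs by simp
    then have "s ! 0 + int i \<le> s ! i" using True by (rule sorted_wrt_less_int_nth)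
    then show ?thesis using True segs(2) by (simp add: xs nth_append)
  next
    case False
    then have "xs ! i \<in> set (concat segs)"
      using assms(2) xs by (metis add_diff_inverse_nat length_append nat_add_left_cancel_less nth_append nth_mem)
    then obtain t where t: "t \<in> set segs" "xs ! i \<in> set t" by auto
    then have "t \<noteq> []" "sorted_wrt (<) t"
      using monotonic_segments_increasing[of t xs] segs by auto
    then have "hd t \<le> xs ! i" using t(2) by (cases t) auto
    then show ?thesis using assms(1) t(1) segs(1) by auto
  qed
qed

section \<open>Back degrees of an optimally labeled graph\<close>

lemma simple_graphE:
  assumes "simple_graph V E" "e \<in> E"
  obtains u v where "e = {u, v}" "u \<in> V" "v \<in> V" "u \<noteq> v"
  using assms unfolding simple_graph_def by blast

lemma simple_graph_edgeD:
  assumes "simple_graph V E" "{u, v} \<in> E"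
  shows "u \<in> V" "v \<in> V" "u \<noteq> v"
  using simple_graphE[OF assms] by (metis doubleton_eq_iff)+

lemma finite_induced_edges: "simple_graph V E \<Longrightarrow> finite (induced_edges E A)"
  by (rule finite_subset[of _ "Pow V"]) (auto simp: simple_graph_def induced_edges_def)

lemma card_induced_edges_insert:
  assumes G: "simple_graph V E" and "finite A" "v \<notin> A"
  shows "card (induced_edges E (insert v A)) =
    card (induced_edges E A) + card {u \<in> A. {u, v} \<in> E}"
proof -
  let ?N = "{u \<in> A. {u, v} \<in> E}"
  have "induced_edges E (insert v A) = induced_edges E A \<union> (\<lambda>u. {u, v}) ` ?N"
  proof
    show "induced_edges E (insert v A) \<subseteq> induced_edges E A \<union> (\<lambda>u. {u, v}) ` ?N"
    proof
      fix e assume e: "e \<in> induced_edges E (insert v A)"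
      then obtain a b where "e = {a, b}" "a \<noteq> b"
        using simple_graphE[OF G, of e] unfolding induced_edges_def by blast
      then consider "e \<subseteq> A" | u where "u \<in> A" "e = {u, v}"
        using e unfolding induced_edges_def by blast
      then show "e \<in> induced_edges E A \<union> (\<lambda>u. {u, v}) ` ?N"
        using e by cases (auto simp: induced_edges_def)
    qed
  qed (auto simp: induced_edges_def)
  moreover have "induced_edges E A \<inter> (\<lambda>u. {u, v}) ` ?N = {}"
    using assms(3) by (auto simp: induced_edges_def)
  moreover have "inj_on (\<lambda>u. {u, v}) ?N"
    by (auto simp: inj_on_def doubleton_eq_iff)
  ultimately show ?thesis
    using assms by (simp add: card_Un_disjoint finite_induced_edges card_image)
qed

lemma card_induced_edges_le_optimal:
  assumes "simple_graph V E" "optimal_set V E A" "B \<subseteq> V" "card B = card A"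
  shows "card (induced_edges E B) \<le> card (induced_edges E A)"
proof -
  let ?M = "{card (induced_edges E C) |C. C \<subseteq> V \<and> card C = card A}"
  have "?M \<subseteq> (\<lambda>C. card (induced_edges E C)) ` Pow V" by blast
  then have "finite ?M"
    using assms(1) by (auto simp: simple_graph_def intro: finite_subset)
  then have "card (induced_edges E B) \<le> Max ?M"
    by (rule Max_ge) (use assms in blast)
  then show ?thesis using assms(2) by (simp add: optimal_set_def max_induced_def)
qed

text \<open>
  Labels start at 0, so \<open>back_degree V E lab j\<close> is the value of the paper's $\delta_G$ at $j + 1$.
\<close>

definition back_degree :: "'a set \<Rightarrow> 'a set set \<Rightarrow> ('a \<Rightarrow> nat) \<Rightarrow> nat \<Rightarrow> nat" where
  "back_degree V E lab j =
    card (induced_edges E {v \<in> V. lab v < Suc j}) - card (induced_edges E {v \<in> V. lab v < j})"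

locale labeled_graph =
  fixes V :: "'a set" and E :: "'a set set" and lab :: "'a \<Rightarrow> nat"
  assumes simple: "simple_graph V E" and labeling: "optimal_labeling V E lab"
begin

abbreviation "n \<equiv> card V"
abbreviation "prefix k \<equiv> {v \<in> V. lab v < k}"
abbreviation "d \<equiv> back_degree V E lab"

lemma finite_V [simp]: "finite V"
  using simple by (simp add: simple_graph_def)

lemma lab_inj: "u \<in> V \<Longrightarrow> v \<in> V \<Longrightarrow> lab u = lab v \<longleftrightarrow> u = v"
  using labeling by (auto simp: optimal_labeling_def bij_betw_def inj_on_def)

lemma lab_less: "v \<in> V \<Longrightarrow> lab v < n"
  using labeling by (auto simp: optimal_labeling_def bij_betw_def)

lemma lab_surj:
  assumes "j < n"
  obtains v where "v \<in> V" "lab v = j"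
proof -
  have "j \<in> lab ` V" using labeling assms by (auto simp: optimal_labeling_def bij_betw_def)
  then show thesis using that by blast
qed

lemma prefix_Suc: "v \<in> V \<Longrightarrow> prefix (Suc (lab v)) = insert v (prefix (lab v))"
  by (auto simp: less_Suc_eq lab_inj)

lemma card_prefix: "k \<le> n \<Longrightarrow> card (prefix k) = k"
proof (induction k)
  case (Suc k)
  then obtain v where "v \<in> V" "lab v = k" using lab_surj[of k] by auto
  then show ?case using Suc prefix_Suc[of v] by simp
qed simp

lemma optimal_prefix: "k \<le> n \<Longrightarrow> optimal_set V E (prefix k)"
  using labeling by (simp add: optimal_labeling_def)

text \<open>Edge counts grow with the prefix, so the truncated subtraction in
  \<open>back_degree\<close> loses nothing.\<close>

lemma induced_edges_prefix_Suc:
  "card (induced_edges E (prefix (Suc j))) = card (induced_edges E (prefix j)) + d j"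
proof -
  have "card (induced_edges E (prefix j)) \<le> card (induced_edges E (prefix (Suc j)))"
    by (intro card_mono finite_induced_edges[OF simple]) (force simp: induced_edges_def)
  then show ?thesis by (simp add: back_degree_def)
qed

lemma back_degree_eq: "v \<in> V \<Longrightarrow> d (lab v) = card {u \<in> prefix (lab v). {u, v} \<in> E}"
  using card_induced_edges_insert[OF simple, of "prefix (lab v)" v] induced_edges_prefix_Suc[of "lab v"]
  by (simp add: prefix_Suc)

lemma induced_edges_empty: "induced_edges E {} = {}"
  using simple by (auto simp: induced_edges_def elim!: simple_graphE)

lemma sum_back_degree: "(\<Sum>j<k. d j) = card (induced_edges E (prefix k))"
  by (induction k) (simp_all add: induced_edges_prefix_Suc induced_edges_empty)

lemma delta_eq_back_degree:
  assumes "j < n"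
  shows "delta V E (Suc j) = int (d j)"
proof -
  have "max_induced V E k = card (induced_edges E (prefix k))" if "k \<le> n" for k
    using optimal_prefix[OF that] card_prefix[OF that] by (simp add: optimal_set_def)
  then show ?thesis using assms induced_edges_prefix_Suc by (simp add: delta_def)
qed

lemma back_degree_0: "d 0 = 0"
proof (cases "V = {}")
  case False
  then have "0 < n" by (simp add: card_gt_0_iff)
  then obtain v where "v \<in> V" "lab v = 0" using lab_surj by blast
  then show ?thesis using back_degree_eq[of v] by simp
qed (simp add: back_degree_def)

text \<open>An exchange argument: \<open>insert v (prefix c)\<close> has the size of the optimal set
  \<open>prefix (Suc c)\<close>, so \<open>v\<close> cannot contribute more edges than the vertex
  labelled \<open>c\<close>.\<close>

lemma card_neighbours_prefix_le:
  assumes "v \<in> V" "c \<le> lab v"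
  shows "card {u \<in> prefix c. {u, v} \<in> E} \<le> d c"
proof -
  have c: "c < n" using assms lab_less[of v] by simp
  have "card (induced_edges E (insert v (prefix c))) \<le> card (induced_edges E (prefix (Suc c)))"
  proof (rule card_induced_edges_le_optimal[OF simple optimal_prefix])
    show "card (insert v (prefix c)) = card (prefix (Suc c))"
      using assms c card_prefix[of c] card_prefix[of "Suc c"] by simp
  qed (use assms c in auto)
  then show ?thesis
    using card_induced_edges_insert[OF simple, of "prefix c" v] induced_edges_prefix_Suc[of c] assms
    by simp
qed

text \<open>The last summand bounds the edges between the two parts, since each vertex of
  \<open>D\<close> has at most \<open>d c\<close> neighbours in \<open>prefix c\<close>.\<close>

lemma card_induced_edges_prefix_Un:
  assumes "finite D" "D \<subseteq> {v \<in> V. c \<le> lab v}"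
  shows "card (induced_edges E (prefix c \<union> D)) \<le>
    card (induced_edges E (prefix c)) + card (induced_edges E D) + card D * d c"
  using assms
proof (induction D rule: finite_induct)
  case (insert v D)
  have "{u \<in> prefix c \<union> D. {u, v} \<in> E} = {u \<in> prefix c. {u, v} \<in> E} \<union> {u \<in> D. {u, v} \<in> E}"
    by blast
  then have "card {u \<in> prefix c \<union> D. {u, v} \<in> E} \<le>
      card {u \<in> prefix c. {u, v} \<in> E} + card {u \<in> D. {u, v} \<in> E}"
    by (simp only: card_Un_le)
  moreover have "card {u \<in> prefix c. {u, v} \<in> E} \<le> d c"
    using insert.prems by (intro card_neighbours_prefix_le) auto
  moreover have "card (induced_edges E (prefix c \<union> insert v D)) =
      card (induced_edges E (prefix c \<union> D)) + card {u \<in> prefix c \<union> D. {u, v} \<in> E}"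
    using card_induced_edges_insert[OF simple, of "prefix c \<union> D" v] insert.hyps insert.prems
    by auto
  moreover have "card (induced_edges E (insert v D)) =
      card (induced_edges E D) + card {u \<in> D. {u, v} \<in> E}"
    using card_induced_edges_insert[OF simple insert.hyps(1,2)] .
  ultimately show ?case using insert.IH insert.hyps insert.prems by simp
qed (simp add: induced_edges_empty)

text \<open>The left side counts the edges gained when the \<open>m\<close> vertices labelled from
  \<open>c\<close> on join \<open>prefix c\<close>. Those among the new vertices are bounded by
  optimality of \<open>prefix m\<close>, the others by \<open>d c\<close> per new vertex.\<close>

lemma sum_back_degree_shift:
  assumes "c + m \<le> n"
  shows "(\<Sum>j<m. d (c + j)) \<le> m * d c + (\<Sum>j<m. d j)"
proof -
  let ?D = "{v \<in> V. c \<le> lab v \<and> lab v < c + m}"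
  have D: "prefix (c + m) = prefix c \<union> ?D" by auto
  have "card (prefix (c + m)) = card (prefix c) + card ?D"
    unfolding D by (rule card_Un_disjoint) auto
  then have card_D: "card ?D = m" using assms by (simp add: card_prefix)
  have "card (induced_edges E ?D) \<le> card (induced_edges E (prefix m))"
    by (rule card_induced_edges_le_optimal[OF simple optimal_prefix])
      (use assms card_D card_prefix[of m] in auto)
  moreover have "card (induced_edges E (prefix c \<union> ?D)) \<le>
      card (induced_edges E (prefix c)) + card (induced_edges E ?D) + card ?D * d c"
    by (rule card_induced_edges_prefix_Un) auto
  moreover have "(\<Sum>j<c + m. d j) = (\<Sum>j<c. d j) + (\<Sum>j<m. d (c + j))"
    by (induction m) simp_all
  ultimately show ?thesis
    using card_D by (simp add: sum_back_degree flip: D)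
qed

text \<open>The case \<open>m = 2\<close> of the shift inequality reduces to
  \<open>d (c + 1) \<le> d c + d 0 + d 1\<close>, and the vertex labelled 1 has a single
  predecessor.\<close>

lemma back_degree_Suc:
  assumes "Suc c < n"
  shows "d (Suc c) \<le> d c + 1"
proof -
  obtain v where v: "v \<in> V" "lab v = 1" using lab_surj[of 1] assms by auto
  have "d 1 \<le> card (prefix 1)"
    using back_degree_eq[OF v(1)] card_mono[of "prefix 1" "{u \<in> prefix 1. {u, v} \<in> E}"]
    unfolding v(2) by auto
  then have "d 1 \<le> 1" using card_prefix[of 1] assms by simp
  then show ?thesis
    using sum_back_degree_shift[of c "Suc (Suc 0)"] assms back_degree_0 by simp
qed

text \<open>The sequence starts with \<open>d 0 = 0\<close>. Hence the entry at position
  \<open>j\<close> is at least \<open>j\<close> in the first run and exceeds 1 in any later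
  run.\<close>

lemma back_degree_ge_2:
  assumes "delta_dense V E" "2 \<le> j" "j < n"
  shows "2 \<le> d j"
proof -
  have nth: "delta_seq V E ! i = int (d i)" if "i < n" for i
    using that delta_eq_back_degree by (simp add: delta_seq_def del: upt_Suc)
  have "delta_seq V E ! 0 + int j \<le> delta_seq V E ! j \<or> 1 < delta_seq V E ! j"
  proof (rule monotonic_segments_nth)
    show "\<forall>s\<in>set (tl (monotonic_segments (delta_seq V E))). 1 < hd s"
      using assms(1) by (simp add: delta_dense_def)
    show "j < length (delta_seq V E)"
      using assms(3) by (simp add: delta_seq_def)
  qed
  then show ?thesis using assms nth[of 0] nth[of j] by auto
qed

end

section \<open>Compressed sets in the square\<close>

lemma simple_graph_square:
  assumes "simple_graph V E"
  shows "simple_graph (V \<times> V) (square_edges V E)"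
  unfolding simple_graph_def
proof
  show "finite (V \<times> V)" using assms by (simp add: simple_graph_def)
  show "square_edges V E \<subseteq> {{p, q} |p q. p \<in> V \<times> V \<and> q \<in> V \<times> V \<and> p \<noteq> q}"
  proof
    fix e assume "e \<in> square_edges V E"
    then obtain x y u v where e: "e = {(x, y), (u, v)}" "x \<in> V" "y \<in> V" "u \<in> V" "v \<in> V"
      and adj: "x = u \<and> {y, v} \<in> E \<or> {x, u} \<in> E \<and> y = v"
      unfolding square_edges_def by blast
    have "(x, y) \<noteq> (u, v)"
      using adj simple_graph_edgeD(3)[OF assms, of y v] simple_graph_edgeD(3)[OF assms, of x u] by auto
    then show "e \<in> {{p, q} |p q. p \<in> V \<times> V \<and> q \<in> V \<times> V \<and> p \<noteq> q}"
      using e by blast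
  qed
qed

lemma square_edges_iff:
  assumes "a \<in> V" "b \<in> V" "u \<in> V" "v \<in> V"
  shows "{(a, b), (u, v)} \<in> square_edges V E \<longleftrightarrow> a = u \<and> {b, v} \<in> E \<or> {a, u} \<in> E \<and> b = v"
proof
  assume "{(a, b), (u, v)} \<in> square_edges V E"
  then obtain x y x' y' where e: "{(a, b), (u, v)} = {(x, y), (x', y')}"
    and adj: "x = x' \<and> {y, y'} \<in> E \<or> {x, x'} \<in> E \<and> y = y'"
    unfolding square_edges_def by blast
  from e consider "a = x" "b = y" "u = x'" "v = y'" | "a = x'" "b = y'" "u = x" "v = y"
    by (auto simp: doubleton_eq_iff)
  then show "a = u \<and> {b, v} \<in> E \<or> {a, u} \<in> E \<and> b = v"
    using adj by cases (simp_all add: insert_commute eq_commute)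
next
  assume "a = u \<and> {b, v} \<in> E \<or> {a, u} \<in> E \<and> b = v"
  then show "{(a, b), (u, v)} \<in> square_edges V E"
    using assms unfolding square_edges_def by blast
qed

section \<open>Linear orders and their initial segments\<close>

lemma linear_order_on_eqI:
  assumes "linear_order_on A r" "antisym s" "s \<subseteq> A \<times> A" "refl_on A s"
    and "\<And>p. p \<in> A \<Longrightarrow> ofilter r {q. (q, p) \<in> s}"
  shows "r = s"
proof
  \<comment> \<open>A filter of \<open>r\<close> that contains \<open>p\<close> contains everything
    \<open>r\<close>-below \<open>p\<close>.\<close>
  show rs: "r \<subseteq> s"
  proof clarify
    fix q p assume qp: "(q, p) \<in> r"
    then have p: "p \<in> A" using assms(1) by (auto simp: order_on_defs)
    then have "p \<in> {q. (q, p) \<in> s}" using assms(4) by (simp add: refl_onD)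
    then have "under r p \<subseteq> {q. (q, p) \<in> s}" using assms(5)[OF p] by (simp add: ofilter_def)
    then show "(q, p) \<in> s" using qp by (auto simp: under_def)
  qed
  \<comment> \<open>Here totality of \<open>r\<close> and antisymmetry of \<open>s\<close> turn the
    first inclusion around.\<close>
  show "s \<subseteq> r"
  proof clarify
    fix q p assume qp: "(q, p) \<in> s"
    then have "p \<in> A" "q \<in> A" using assms(3) by auto
    then have "(q, p) \<in> r \<or> (p, q) \<in> r"
      using assms(1) unfolding order_on_defs total_on_def refl_on_def by metis
    then show "(q, p) \<in> r" using rs qp antisymD[OF assms(2)] by auto
  qed
qed

text \<open>On a finite carrier the strict part of \<open>r\<close> is well-founded, so there is a
  least element outside \<open>S\<close>; it is the one to append.\<close>

lemma ofilter_extend: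
  assumes "finite A" "linear_order_on A r" "ofilter r S" "S \<noteq> A"
  shows "\<exists>p\<in>A. p \<notin> S \<and> ofilter r (insert p S)"
proof -
  have r: "r \<subseteq> A \<times> A" "refl_on A r" "antisym r"
    using assms(2) by (auto simp: order_on_defs)
  then have Field: "Field r = A" by (auto simp: Field_def refl_on_def)
  have "wf (r - Id)"
    using assms r by (intro partial_order_on_well_order_on[of r A])
      (auto simp: linear_order_on_def intro: finite_subset)
  moreover obtain q where "q \<in> A - S"
    using assms(3,4) Field by (auto simp: ofilter_def)
  ultimately obtain p where p: "p \<in> A - S" "\<And>q. (q, p) \<in> r - Id \<Longrightarrow> q \<notin> A - S"
    by (rule wfE_min) blast
  then have "under r p \<subseteq> insert p S" using r(1) by (auto simp: under_def)
  then have "ofilter r (insert p S)"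
    using assms(3) p(1) Field by (auto simp: ofilter_def)
  then show ?thesis using p(1) by blast
qed

section \<open>Transfer between vertex pairs and the grid of labels\<close>

context labeled_graph
begin

definition pull :: "(nat \<times> nat) set \<Rightarrow> ('a \<times> 'a) set" where
  "pull A = {p \<in> V \<times> V. map_prod lab lab p \<in> A}"

lemma pull_iff: "(u, v) \<in> pull A \<longleftrightarrow> u \<in> V \<and> v \<in> V \<and> (lab u, lab v) \<in> A"
  by (auto simp: pull_def)

lemma finite_pull [simp]: "finite (pull A)"
  unfolding pull_def by simp

lemma pull_insert:
  "u \<in> V \<Longrightarrow> v \<in> V \<Longrightarrow> pull (insert (lab u, lab v) A) = insert (u, v) (pull A)"
  by (auto simp: pull_def lab_inj)

lemma card_pull:
  assumes "A \<subseteq> {..<n} \<times> {..<n}"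
  shows "card (pull A) = card A"
proof (rule bij_betw_same_card)
  show "bij_betw (map_prod lab lab) (pull A) A"
    unfolding bij_betw_def
  proof
    show "inj_on (map_prod lab lab) (pull A)"
      by (auto simp: inj_on_def pull_iff lab_inj)
    show "map_prod lab lab ` pull A = A"
    proof
      show "A \<subseteq> map_prod lab lab ` pull A"
      proof
        fix p assume p: "p \<in> A"
        obtain x y where xy: "p = (x, y)" by fastforce
        then have "x < n" "y < n" using p assms by auto
        then obtain u v where "u \<in> V" "lab u = x" "v \<in> V" "lab v = y" using lab_surj by metis
        then show "p \<in> map_prod lab lab ` pull A"
          using p xy by (auto simp: pull_iff intro!: rev_image_eqI[of "(u, v)"])
      qed
    qed (auto simp: pull_def)
  qed
qed

text \<open>Compression closes each line of the square downwards. Descending first in the second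
  coordinate and then in the first, through \<open>(x, y')\<close>, reaches every smaller
  cell.\<close>

lemma compressed_pull_lower_set:
  assumes "compressed V lab (pull A)" "A \<subseteq> {..<n} \<times> {..<n}"
  shows "lower_set A"
  unfolding lower_set_def
proof (intro allI impI)
  fix x y x' y' assume A: "(x, y) \<in> A" and le: "x' \<le> x" "y' \<le> y"
  then have "x < n" "y < n" using assms(2) by auto
  then have "x' < n" "y' < n" using le by auto
  obtain u where u: "u \<in> V" "lab u = x" using lab_surj \<open>x < n\<close> by blast
  obtain v where v: "v \<in> V" "lab v = y" using lab_surj \<open>y < n\<close> by blast
  obtain u' where u': "u' \<in> V" "lab u' = x'" using lab_surj \<open>x' < n\<close> by blast
  obtain v' where v': "v' \<in> V" "lab v' = y'" using lab_surj \<open>y' < n\<close> by blast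
  obtain k where k: "lab ` {b. (u, b) \<in> pull A} = {0..<k}"
    using assms(1) u(1) unfolding compressed_def by blast
  have "y \<in> lab ` {b. (u, b) \<in> pull A}" using A u v by (auto simp: pull_iff)
  then have "y' \<in> lab ` {b. (u, b) \<in> pull A}" unfolding k using le by simp
  then have A': "(x, y') \<in> A" using u by (auto simp: pull_iff)
  obtain l where l: "lab ` {a. (a, v') \<in> pull A} = {0..<l}"
    using assms(1) v'(1) unfolding compressed_def by blast
  have "x \<in> lab ` {a. (a, v') \<in> pull A}" using A' u v' by (auto simp: pull_iff)
  then have "x' \<in> lab ` {a. (a, v') \<in> pull A}" unfolding l using le by simp
  then show "(x', y') \<in> A" using v' by (auto simp: pull_iff)
qed

text \<open>The set is built corner by corner. A new corner gains \<open>d x\<close> edges from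
  earlier neighbours of \<open>u\<close> and \<open>d y\<close> edges from earlier neighbours of
  \<open>v\<close>.\<close>

lemma card_induced_square_edges_pull:
  assumes "lower_set A" "A \<subseteq> {..<n} \<times> {..<n}"
  shows "card (induced_edges (square_edges V E) (pull A)) = weight d A"
proof -
  have "finite A" using assms(2) finite_subset by blast
  then show ?thesis using assms
  proof (induction A rule: lower_set_induct)
    case empty
    have "pull {} = {}" by (auto simp: pull_def)
    moreover have "induced_edges (square_edges V E) {} = {}"
      by (auto simp: induced_edges_def square_edges_def)
    ultimately show ?case by (simp add: weight_def)
  next
    case (insert x y A)
    obtain u where u: "u \<in> V" "lab u = x" using lab_surj insert.prems by auto
    obtain v where v: "v \<in> V" "lab v = y" using lab_surj insert.prems by auto
    let ?Nu = "{a \<in> prefix x. {a, u} \<in> E}" and ?Nv = "{b \<in> prefix y. {b, v} \<in> E}"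
    \<comment> \<open>In the row and the column of the new corner, exactly the cells before it are
      present.\<close>
    have below: "(x', y') \<in> A" if "x' \<le> x" "y' \<le> y" "x' < x \<or> y' < y" for x' y'
      using lower_setD[OF insert.hyps(3), of x y x' y'] that by auto
    have not_above: "x' < x \<or> y' < y" if "(x', y') \<in> A" for x' y'
      using lower_setD[OF insert.hyps(2) that, of x y] insert.hyps(4) by force
    have "{q \<in> pull A. {q, (u, v)} \<in> square_edges V E} = ?Nu \<times> {v} \<union> {u} \<times> ?Nv"
    proof (rule set_eqI, clarify)
      fix a b
      show "(a, b) \<in> {q \<in> pull A. {q, (u, v)} \<in> square_edges V E} \<longleftrightarrow>
          (a, b) \<in> ?Nu \<times> {v} \<union> {u} \<times> ?Nv"
        using u v below[of "lab a" y] below[of x "lab b"] not_above[of "lab a" "lab b"]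
        by (auto simp: pull_iff square_edges_iff)
    qed
    moreover have "card (?Nu \<times> {v} \<union> {u} \<times> ?Nv) = card ?Nu + card ?Nv"
      using u v by (subst card_Un_disjoint) (auto simp: card_cartesian_product)
    moreover have "card ?Nu = d x" "card ?Nv = d y"
      using back_degree_eq u v by auto
    moreover have "(u, v) \<notin> pull A" using u v insert.hyps(4) by (simp add: pull_iff)
    moreover have "pull (insert (x, y) A) = insert (u, v) (pull A)"
      using pull_insert u v by blast
    ultimately have "card (induced_edges (square_edges V E) (pull (insert (x, y) A))) =
        card (induced_edges (square_edges V E) (pull A)) + (d x + d y)"
      using card_induced_edges_insert[OF simple_graph_square[OF simple] finite_pull] by simp
    then show ?case
      using insert by (simp add: weight_insert)
  qed
qed

text \<open>Optimality in the square is invoked only against lower sets, since for these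
  \<open>weight\<close> counts the induced edges.\<close>

lemma staircase_chain_ofilters:
  assumes "delta_dense V E" "compressed_optimal_order V E lab r"
  shows "staircase_chain n d {A. A \<subseteq> {..<n} \<times> {..<n} \<and> ofilter r (pull A)}"
proof -
  have lin: "linear_order_on (V \<times> V) r"
    and opt: "\<And>S. ofilter r S \<Longrightarrow> optimal_set (V \<times> V) (square_edges V E) S"
    and comp: "\<And>S. ofilter r S \<Longrightarrow> compressed V lab S"
    using assms(2) by (auto simp: compressed_optimal_order_def)
  let ?F = "{A. A \<subseteq> {..<n} \<times> {..<n} \<and> ofilter r (pull A)}"
  have lower: "lower_set A" if "A \<in> ?F" for A
    using compressed_pull_lower_set comp that by blast
  show ?thesis
  proof
    show "{} \<in> ?F" by (simp add: pull_def ofilter_def)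
  next
    fix S assume S: "S \<in> ?F" "S \<noteq> {..<n} \<times> {..<n}"
    \<comment> \<open>\<open>pull\<close> preserves the size of grid sets, so \<open>pull S\<close>
      is not all of \<open>V \<times> V\<close> and the filter can be extended.\<close>
    have "card (pull S) < card (V \<times> V)"
      using S card_pull[of S] psubset_card_mono[of "{..<n} \<times> {..<n}" S] by auto
    then obtain u v where p: "u \<in> V" "v \<in> V" "(u, v) \<notin> pull S" "ofilter r (insert (u, v) (pull S))"
      using ofilter_extend[OF _ lin, of "pull S"] S by fastforce
    then have "(lab u, lab v) \<notin> S \<and> insert (lab u, lab v) S \<in> ?F"
      using S by (simp add: pull_iff pull_insert lab_less)
    then show "\<exists>p. p \<notin> S \<and> insert p S \<in> ?F" by blast
  next
    fix S T assume S: "S \<in> ?F" and T: "T \<subseteq> {..<n} \<times> {..<n}" "lower_set T" "card T = card S"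
    have "card (induced_edges (square_edges V E) (pull T))
        \<le> card (induced_edges (square_edges V E) (pull S))"
      by (rule card_induced_edges_le_optimal[OF simple_graph_square[OF simple] opt])
        (use S T in \<open>auto simp: card_pull pull_iff\<close>)
    then show "weight d T \<le> weight d S"
      using S T lower[OF S] by (simp add: card_induced_square_edges_pull)
  next
    show "d 0 = 0" by (rule back_degree_0)
    show "d (Suc c) \<le> d c + 1" if "Suc c < n" for c
      using that by (rule back_degree_Suc)
    show "2 \<le> d j" if "2 \<le> j" "j < n" for j
      using assms(1) that by (rule back_degree_ge_2)
    show "(\<Sum>j<m. d (c + j)) \<le> m * d c + (\<Sum>j<m. d j)" if "c + m \<le> n" for c m
      using that by (rule sum_back_degree_shift)
    show "S \<subseteq> {..<n} \<times> {..<n}" if "S \<in> ?F" for S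
      using that by blast
    show "lower_set S" if "S \<in> ?F" for S
      using that by (rule lower)
  qed
qed

section \<open>Principal down-sets of the two target orders\<close>

lemma lex_order_below:
  assumes "u \<in> V" "v \<in> V"
  shows "{q. (q, (u, v)) \<in> lex_order V lab} = pull (lex_segment n (lab u) (Suc (lab v)))"
proof (rule set_eqI, clarify)
  fix a b
  show "(a, b) \<in> {q. (q, (u, v)) \<in> lex_order V lab} \<longleftrightarrow>
      (a, b) \<in> pull (lex_segment n (lab u) (Suc (lab v)))"
    using assms lab_inj[of a u] lab_inj[of b v] lab_less[of b]
    by (simp add: lex_order_def pull_iff lex_segment_def less_Suc_eq) blast
qed

lemma colex_order_below:
  assumes "u \<in> V" "v \<in> V"
  shows "{q. (q, (u, v)) \<in> colex_order V lab} = pull (prod.swap ` lex_segment n (lab v) (Suc (lab u)))"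
proof (rule set_eqI, clarify)
  fix a b
  show "(a, b) \<in> {q. (q, (u, v)) \<in> colex_order V lab} \<longleftrightarrow>
      (a, b) \<in> pull (prod.swap ` lex_segment n (lab v) (Suc (lab u)))"
    using assms lab_inj[of a u] lab_inj[of b v] lab_less[of a]
    by (simp add: colex_order_def pull_iff mem_swap_image lex_segment_def less_Suc_eq) blast
qed

lemma antisym_lex_order: "antisym (lex_order V lab)"
proof (rule antisymI)
  fix p q assume "(p, q) \<in> lex_order V lab" "(q, p) \<in> lex_order V lab"
  moreover have "\<not> (lex_less lab p q \<and> lex_less lab q p)" by (cases p; cases q) (simp, linarith)
  ultimately show "p = q" unfolding lex_order_def by blast
qed

lemma antisym_colex_order: "antisym (colex_order V lab)"
proof (rule antisymI)
  fix p q assume "(p, q) \<in> colex_order V lab" "(q, p) \<in> colex_order V lab"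
  moreover have "\<not> (colex_less lab p q \<and> colex_less lab q p)" by (cases p; cases q) (simp, linarith)
  ultimately show "p = q" unfolding colex_order_def by blast
qed

end

theorem theorem8:
  fixes V :: "'a set" and E :: "'a set set"
    and lab :: "'a \<Rightarrow> nat" and r :: "('a \<times> 'a) rel"
  assumes "simple_graph V E"
    and "delta_dense V E"
    and "nested_solutions V E"
    and "nested_solutions (V \<times> V) (square_edges V E)"
    and "optimal_labeling V E lab"
    and "compressed_optimal_order V E lab r"
  shows "r = lex_order V lab \<or> r = colex_order V lab"
proof -
  interpret labeled_graph V E lab
    using assms by unfold_locales
  interpret staircase_chain n d "{A. A \<subseteq> {..<n} \<times> {..<n} \<and> ofilter r (pull A)}"
    using assms by (intro staircase_chain_ofilters)
  have lin: "linear_order_on (V \<times> V) r"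
    using assms(6) by (simp add: compressed_optimal_order_def)
  from lex_or_colex show ?thesis
  proof
    assume *: "\<forall>c<n. \<forall>j\<le>n. lex_segment n c j \<in> {A. A \<subseteq> {..<n} \<times> {..<n} \<and> ofilter r (pull A)}"
    have "r = lex_order V lab"
    \<comment> \<open>It suffices that each principal down-set of the lexicographic order, which is
      a pulled-back segment, is a filter of \<open>r\<close>.\<close>
    proof (rule linear_order_on_eqI[OF lin antisym_lex_order])
      fix p assume "p \<in> V \<times> V"
      then obtain u v where p: "p = (u, v)" "u \<in> V" "v \<in> V" by blast
      then have "ofilter r (pull (lex_segment n (lab u) (Suc (lab v))))"
        using * lab_less[of u] lab_less[of v] by (simp add: Suc_le_eq)
      then show "ofilter r {q. (q, p) \<in> lex_order V lab}"
        by (simp only: p lex_order_below)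
    qed (auto simp: lex_order_def refl_on_def)
    then show ?thesis ..
  next
    assume *: "\<forall>c<n. \<forall>j\<le>n. prod.swap ` lex_segment n c j
      \<in> {A. A \<subseteq> {..<n} \<times> {..<n} \<and> ofilter r (pull A)}"
    have "r = colex_order V lab"
    proof (rule linear_order_on_eqI[OF lin antisym_colex_order])
      fix p assume "p \<in> V \<times> V"
      then obtain u v where p: "p = (u, v)" "u \<in> V" "v \<in> V" by blast
      then have "ofilter r (pull (prod.swap ` lex_segment n (lab v) (Suc (lab u))))"
        using * lab_less[of u] lab_less[of v] by (simp add: Suc_le_eq)
      then show "ofilter r {q. (q, p) \<in> colex_order V lab}"
        by (simp only: p colex_order_below)
    qed (auto simp: colex_order_def refl_on_def)
    then show ?thesis ..
  qed
qed

end
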